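(* Let $m$ be a positive integer such that $m+1$ is not a power of $2$. Then $s(m)\leq r(m)$, where $s(m)$ and $r(m)$ are defined in the context.
   Context: All cohomology is singular cohomology with coefficients in $\mathbb{Z}_2=\mathbb{Z}/2$. For an integer $s\geq 2$ and a space $X$, the $s$-th zero-divisor cup-length $\mathrm{zcl}_s(X)$ is the maximal number of elements of $\ker(\Delta_s^*\colon H^*(X^s)\to H^*(X))$ having a non-zero product, where $\Delta_s\colon X\to X^s$ is the $s$-fold iterated diagonal. For $X=\mathbb{R}P^m$, $H^*((\mathbb{R}P^m)^s)=\mathbb{Z}_2[x_1,\ldots,x_s]/(x_1^{m+1},\ldots,x_s^{m+1})$ with each $x_i$ of degree $1$, and $\Delta_s^*$ is the ring homomorphism to $H^*(\mathbb{R}P^m)=\mathbb{Z}_2[x]/(x^{m+1})$ sending every $x_i$ to $x$. Put $G_s(m)=sm-\mathrm{zcl}_s(\mathbb{R}P^m)$ for $s\geq 2$. It is known that $\{G_s(m)\}_{s\geq 2}$ is a non-increasing sequence of non-negative integers; hence it is eventually constant, and $G(m)$ denotes its stable value. The integer $s(m)$ is the smallest integer $\geq 2$ such that $G_s(m)=G(m)$ for all $s\geq s(m)$. Definition of $r(m)$. Let $m$ be a positive integer such that $m+1$ is not a power of $2$. Let $e=e(m)\geq 0$ be the integer defined by $m\equiv 2^{e}-1 \bmod 2^{e+1}$, i.e. the length of the block of consecutive ones ending the binary expansion of $m$ ($e=0$ if $m$ is even). Let $k$ be the least positive integer with $2^k>m$, and set $d_0=2^k-m-1$, which is a positive integer divisible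 by $2^e$. Let $t=(d_0-2^e)/2^e$ and, for $1\leq \ell\leq t$, let $d_\ell=d_0-2^e\ell$ (so $d_0>d_1>\cdots>d_t=2^e$). Define non-negative integers $r_\ell$, $0\leq\ell\leq t$, recursively by $$r_\ell=\begin{cases}\left\lfloor \dfrac{m-(2^e-1)-\sum_{i=0}^{\ell-1}d_i r_i}{d_\ell}\right\rfloor, & \text{if } \binom{m+d_\ell}{d_\ell}\equiv 1 \bmod 2;\\[2mm] 0, & \text{otherwise.}\end{cases}$$ Finally, $r(m)=1+\sum_{\ell=0}^{t} r_\ell$. *)

theory Defs
  imports
    Complex_Main
    "HOL-Algebra.QuotRing"
    "HOL-Number_Theory.Cong"
    "HOL-Library.Poly_Mapping"
    "HOL-Library.Z2"
begin

section \<open>The mod 2 cohomology ring of a power of real projective space\<close>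

text \<open>
  A monomial is a finitely supported exponent function \<^typ>\<open>nat \<Rightarrow>\<^sub>0 nat\<close>, so that
  \<^typ>\<open>(nat \<Rightarrow>\<^sub>0 nat) \<Rightarrow>\<^sub>0 bit\<close> is the ring of polynomials over the two-element field in
  countably many indeterminates. Only the indeterminates $x_1, \dots, x_s$ occur in
  the elements of \<open>mpoly2 s\<close>.
\<close>

definition mpoly2 :: "nat \<Rightarrow> ((nat \<Rightarrow>\<^sub>0 nat) \<Rightarrow>\<^sub>0 bit) ring" where
  "mpoly2 s = \<lparr>carrier = {p. \<forall>a\<in>Poly_Mapping.keys p. Poly_Mapping.keys a \<subseteq> {1..s}},
     monoid.mult = (*), one = 1, zero = 0, add = (+)\<rparr>"

definition indet :: "nat \<Rightarrow> (nat \<Rightarrow>\<^sub>0 nat) \<Rightarrow>\<^sub>0 bit" where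
  "indet i = Poly_Mapping.single (Poly_Mapping.single i 1) 1"

definition trunc_ideal :: "nat \<Rightarrow> nat \<Rightarrow> ((nat \<Rightarrow>\<^sub>0 nat) \<Rightarrow>\<^sub>0 bit) set" where
  "trunc_ideal s m = genideal (mpoly2 s) ((\<lambda>i. indet i ^ (m + 1)) ` {1..s})"

text \<open>
  The singular cohomology ring of $(\mathbb{R}P^m)^s$ with coefficients in the
  two-element field is taken in its standard presentation
  $\mathbb{Z}_2[x_1,\dots,x_s]/(x_1^{m+1},\dots,x_s^{m+1})$; the ring of
  $\mathbb{R}P^m$ itself is the case $s = 1$.
\<close>

definition cohom_RP :: "nat \<Rightarrow> nat \<Rightarrow> ((nat \<Rightarrow>\<^sub>0 nat) \<Rightarrow>\<^sub>0 bit) set ring" where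
  "cohom_RP s m = mpoly2 s Quot trunc_ideal s m"

definition cohom_gen :: "nat \<Rightarrow> nat \<Rightarrow> nat \<Rightarrow> ((nat \<Rightarrow>\<^sub>0 nat) \<Rightarrow>\<^sub>0 bit) set" where
  "cohom_gen s m i = trunc_ideal s m +>\<^bsub>mpoly2 s\<^esub> indet i"

text \<open>
  The map induced by the \<open>s\<close>-fold diagonal: the ring homomorphism sending every $x_i$ to
  $x$. Extensionality pins down its (irrelevant) values outside the carrier, which makes
  it unique as a function.
\<close>

definition diag_hom ::
  "nat \<Rightarrow> nat \<Rightarrow> ((nat \<Rightarrow>\<^sub>0 nat) \<Rightarrow>\<^sub>0 bit) set \<Rightarrow> ((nat \<Rightarrow>\<^sub>0 nat) \<Rightarrow>\<^sub>0 bit) set" where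
  "diag_hom s m = (THE h. h \<in> ring_hom (cohom_RP s m) (cohom_RP 1 m)
     \<and> h \<in> extensional (carrier (cohom_RP s m))
     \<and> (\<forall>i\<in>{1..s}. h (cohom_gen s m i) = cohom_gen 1 m 1))"


section \<open>Zero-divisor cup-length and the stabilisation index\<close>

text \<open>
  The maximal number of (not necessarily distinct) elements of the kernel of \<open>h\<close> with
  non-zero product; the empty product is \<open>\<one>\<close>.
\<close>

definition kernel_cup_length ::
  "('a, 'c) ring_scheme \<Rightarrow> ('b, 'd) ring_scheme \<Rightarrow> ('a \<Rightarrow> 'b) \<Rightarrow> nat" where
  "kernel_cup_length A B h =
     Max {n. \<exists>u \<in> {..<n} \<rightarrow> a_kernel A B h. (\<Otimes>\<^bsub>A\<^esub>j\<in>{..<n}. u j) \<noteq> \<zero>\<^bsub>A\<^esub>}"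

definition zcl_RP :: "nat \<Rightarrow> nat \<Rightarrow> nat" where
  "zcl_RP s m = kernel_cup_length (cohom_RP s m) (cohom_RP 1 m) (diag_hom s m)"

definition gap :: "nat \<Rightarrow> nat \<Rightarrow> int" where
  "gap s m = int (s * m) - int (zcl_RP s m)"

definition stable_gap :: "nat \<Rightarrow> int" where
  "stable_gap m = (THE c. \<forall>\<^sub>F s in sequentially. gap s m = c)"

definition stab_index :: "nat \<Rightarrow> nat" where
  "stab_index m = (LEAST s. 2 \<le> s \<and> (\<forall>t\<ge>s. gap t m = stable_gap m))"


section \<open>The upper bound\<close>

definition ones_block :: "nat \<Rightarrow> nat" where
  "ones_block m = (THE e. [m = 2 ^ e - 1] (mod 2 ^ (e + 1)))"

definition bit_len :: "nat \<Rightarrow> nat" where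
  "bit_len m = (LEAST k. 0 < k \<and> m < 2 ^ k)"

text \<open>
  \<open>dd m l\<close> is $d_l$ and \<open>last_idx m\<close> is $t$. Natural-number subtraction is exact in
  \<open>dd m l\<close> for $l \leq t$; larger indices are never used in \<open>r_bound\<close>.
\<close>

definition dd :: "nat \<Rightarrow> nat \<Rightarrow> nat" where
  "dd m l = (2 ^ bit_len m - m - 1) - 2 ^ ones_block m * l"

definition last_idx :: "nat \<Rightarrow> nat" where
  "last_idx m = (dd m 0 - 2 ^ ones_block m) div 2 ^ ones_block m"

fun rr :: "nat \<Rightarrow> nat \<Rightarrow> int" where
  "rr m l =
     (if [(m + dd m l) choose dd m l = 1] (mod 2)
      then \<lfloor>real_of_int (int m - (2 ^ ones_block m - 1) - (\<Sum>i<l. int (dd m i) * rr m i))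
             / real (dd m l)\<rfloor>
      else 0)"

declare rr.simps [simp del]

definition r_bound :: "nat \<Rightarrow> int" where
  "r_bound m = 1 + (\<Sum>l=0..last_idx m. rr m l)"

end

theory Submission
  imports Defs
begin

text \<open>
  In fact $G_s(m) = 2^e - 1$ for every $s \<ge> r(m)$. Write $m + 1 = 2^e M$ with $M$ odd. The kernel of
  the diagonal is generated by the $x_i + x_1$, so the cup-length is the largest degree of a
  non-zero product of powers of these. Since $(x_i + x_1)^{2^e} = x_i^{2^e} + x_1^{2^e}$, such a product
  is, up to a factor of degree at most $(s - 1)(2^e - 1)$, a polynomial in the $x_i^{2^e}$, and these
  generate a truncated ring with top degree $2^e s (M - 1)$; the cup-length is therefore at most
  $sm - (2^e - 1)$. Conversely, in the product of the $(x_i + x_1)^{m + c_i}$ over $2 \<le> i \<le> s$ the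
  coefficient of $x_1^{c_2 + \<cdots> + c_s} x_2^m \<cdots> x_s^m$ is the product of the binomial coefficients
  of $m + c_i$ over $m$. The recursion for the $r_l$ is the greedy algorithm that writes
  $m - (2^e - 1)$ as a sum of $r(m) - 1$ numbers $c_i$ for which they are all odd, and
  the remaining $c_i$ can be taken to be $0$.
\<close>

section \<open>Polynomials over the two-element field\<close>

type_synonym poly2 = "(nat \<Rightarrow>\<^sub>0 nat) \<Rightarrow>\<^sub>0 bit"

lemma poly2_add_self: "p + p = 0" for p :: "'a \<Rightarrow>\<^sub>0 bit"
  by (rule poly_mapping_eqI) (simp add: lookup_add)

lemma poly2_expand: "p = (\<Sum>a\<in>Poly_Mapping.keys p. Poly_Mapping.single a 1)"
  for p :: "'a \<Rightarrow>\<^sub>0 bit"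
proof (rule poly_mapping_eqI)
  fix k
  have "Poly_Mapping.lookup (\<Sum>a\<in>Poly_Mapping.keys p. Poly_Mapping.single a (1::bit)) k
      = (\<Sum>a\<in>Poly_Mapping.keys p. if a = k then 1 else 0)"
    by (simp add: lookup_sum lookup_single when_def)
  also have "\<dots> = (if k \<in> Poly_Mapping.keys p then 1 else 0)"
    by simp
  also have "\<dots> = Poly_Mapping.lookup p k"
    by (simp add: in_keys_iff bit_not_zero_iff)
  finally show "Poly_Mapping.lookup p k = Poly_Mapping.lookup (\<Sum>a\<in>Poly_Mapping.keys p. Poly_Mapping.single a 1) k" ..
qed

text \<open>Every coefficient is 0 or 1, so a polynomial is the sum of the monomials in its support.
  The monomial case retains that \<open>a\<close> lies in the support of \<open>p\<close>, so
  conditions on the support of \<open>p\<close> are available there.\<close>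

lemma poly2_induct [case_names zero monom add]:
  fixes p :: "'a \<Rightarrow>\<^sub>0 bit"
  assumes "P 0" "\<And>a. a \<in> Poly_Mapping.keys p \<Longrightarrow> P (Poly_Mapping.single a 1)"
    "\<And>f g. P f \<Longrightarrow> P g \<Longrightarrow> P (f + g)"
  shows "P p"
proof -
  have "P (\<Sum>a\<in>A. Poly_Mapping.single a 1)" if "finite A" "A \<subseteq> Poly_Mapping.keys p" for A
    using that by (induction A rule: finite_induct) (auto intro: assms)
  from this [of "Poly_Mapping.keys p"] show ?thesis
    by (simp add: poly2_expand [symmetric])
qed

lemma keys_multE:
  assumes "a \<in> Poly_Mapping.keys (p * q)"
  obtains b c where "b \<in> Poly_Mapping.keys p" "c \<in> Poly_Mapping.keys q" "a = b + c"
  using assms keys_mult [of p q] by blast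

lemma keys_plus_nat: "Poly_Mapping.keys (a + b) = Poly_Mapping.keys a \<union> Poly_Mapping.keys b"
  for a b :: "'a \<Rightarrow>\<^sub>0 nat"
  by (auto simp: in_keys_iff lookup_add)


lemma indet_power: "indet i ^ n = Poly_Mapping.single (Poly_Mapping.single i n) 1"
proof (induction n)
  case (Suc n)
  then show ?case
    by (simp add: indet_def mult_single single_add [symmetric] del: single_add)
qed simp

section \<open>Total degree and the diagonal on polynomials\<close>

definition total_deg :: "(nat \<Rightarrow>\<^sub>0 nat) \<Rightarrow> nat" where
  "total_deg a = (\<Sum>i\<in>Poly_Mapping.keys a. Poly_Mapping.lookup a i)"

lemma total_deg_add: "total_deg (a + b) = total_deg a + total_deg b"
  unfolding total_deg_def by (rule setsum_keys_plus_distrib) auto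

lemma total_deg_single [simp]: "total_deg (Poly_Mapping.single i n) = n"
  by (simp add: total_deg_def)

lemma total_deg_zero [simp]: "total_deg 0 = 0"
  by (simp add: total_deg_def)

lemma lookup_le_total_deg: "Poly_Mapping.lookup a i \<le> total_deg a"
proof (cases "i \<in> Poly_Mapping.keys a")
  case True
  then show ?thesis
    unfolding total_deg_def by (intro member_le_sum) auto
qed (simp add: in_keys_iff)

text \<open>The substitution of \<open>indet 1\<close> for every variable: a monomial becomes the
  power of \<open>indet 1\<close> of the same total degree, and monomials of equal degree cancel in
  pairs.\<close>

definition diag_poly :: "poly2 \<Rightarrow> poly2" where
  "diag_poly p = (\<Sum>a\<in>Poly_Mapping.keys p.
     Poly_Mapping.single (Poly_Mapping.single 1 (total_deg a)) (Poly_Mapping.lookup p a))"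

lemma diag_poly_add: "diag_poly (p + q) = diag_poly p + diag_poly q"
  unfolding diag_poly_def by (rule setsum_keys_plus_distrib) (simp, simp only: single_add)

lemma diag_poly_zero [simp]: "diag_poly 0 = 0"
  by (simp add: diag_poly_def)

lemma diag_poly_single [simp]:
  "diag_poly (Poly_Mapping.single a 1) = Poly_Mapping.single (Poly_Mapping.single 1 (total_deg a)) 1"
  by (simp add: diag_poly_def)

lemma diag_poly_one [simp]: "diag_poly 1 = 1"
  using diag_poly_single [of 0] by (simp del: diag_poly_single)

lemma diag_poly_mult: "diag_poly (p * q) = diag_poly p * diag_poly q"
proof (induction p rule: poly2_induct)
  case (monom a)
  show ?case
    by (induction q rule: poly2_induct)
      (auto simp: mult_single total_deg_add single_add diag_poly_add distrib_left)
qed (auto simp: distrib_right diag_poly_add)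

lemma diag_poly_indet [simp]: "diag_poly (indet i) = indet 1"
  by (simp add: indet_def)

section \<open>Polynomials in given variables and the truncation ideal\<close>

definition polys_over :: "nat set \<Rightarrow> poly2 set" where
  "polys_over V = {p. \<forall>a\<in>Poly_Mapping.keys p. Poly_Mapping.keys a \<subseteq> V}"

text \<open>A monomial ideal, so membership is tested on the support. The variables that occur are
  not restricted; intersecting with \<open>polys_over {1..s}\<close> gives
  \<open>trunc_ideal s m\<close>.\<close>

definition trunc_polys :: "nat \<Rightarrow> nat \<Rightarrow> poly2 set" where
  "trunc_polys s m = {p. \<forall>a\<in>Poly_Mapping.keys p. \<exists>i\<in>{1..s}. m < Poly_Mapping.lookup a i}"

lemma polys_over_closed:
  shows "0 \<in> polys_over V" "1 \<in> polys_over V"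
    and "p \<in> polys_over V \<Longrightarrow> q \<in> polys_over V \<Longrightarrow> p + q \<in> polys_over V"
    and "p \<in> polys_over V \<Longrightarrow> q \<in> polys_over V \<Longrightarrow> p * q \<in> polys_over V"
    and "i \<in> V \<Longrightarrow> indet i \<in> polys_over V"
proof -
  show "0 \<in> polys_over V" "1 \<in> polys_over V" "i \<in> V \<Longrightarrow> indet i \<in> polys_over V"
    by (auto simp: polys_over_def indet_def)
  show "p + q \<in> polys_over V" if "p \<in> polys_over V" "q \<in> polys_over V"
    using that keys_add [of p q] unfolding polys_over_def by blast
  show "p * q \<in> polys_over V" if "p \<in> polys_over V" "q \<in> polys_over V"
    unfolding polys_over_def
  proof (intro CollectI ballI)
    fix a
    assume "a \<in> Poly_Mapping.keys (p * q)"
    then obtain b c where "b \<in> Poly_Mapping.keys p" "c \<in> Poly_Mapping.keys q" "a = b + c"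
      by (rule keys_multE)
    with that show "Poly_Mapping.keys a \<subseteq> V"
      by (auto simp: polys_over_def keys_plus_nat)
  qed
qed

lemma polys_over_power: "p \<in> polys_over V \<Longrightarrow> p ^ n \<in> polys_over V"
  by (induction n) (auto intro: polys_over_closed)

lemma polys_over_prod: "(\<And>i. i \<in> A \<Longrightarrow> f i \<in> polys_over V) \<Longrightarrow> prod f A \<in> polys_over V"
  by (induction A rule: infinite_finite_induct) (auto intro: polys_over_closed)

lemma trunc_polys_add: "p \<in> trunc_polys s m \<Longrightarrow> q \<in> trunc_polys s m \<Longrightarrow> p + q \<in> trunc_polys s m"
  using keys_add [of p q] unfolding trunc_polys_def by blast

lemma trunc_polys_zero [simp]: "0 \<in> trunc_polys s m"
  by (simp add: trunc_polys_def)

lemma trunc_polys_mult: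
  assumes "p \<in> trunc_polys s m"
  shows "q * p \<in> trunc_polys s m"
  unfolding trunc_polys_def
proof (intro CollectI ballI)
  fix a
  assume "a \<in> Poly_Mapping.keys (q * p)"
  then obtain b c where "c \<in> Poly_Mapping.keys p" "a = b + c"
    by (rule keys_multE)
  with assms show "\<exists>i\<in>{1..s}. m < Poly_Mapping.lookup a i"
    unfolding trunc_polys_def by (auto simp: lookup_add intro: trans_less_add2)
qed

lemma diag_poly_polys_over: "1 \<in> V \<Longrightarrow> diag_poly p \<in> polys_over V"
  by (induction p rule: poly2_induct)
    (auto simp: diag_poly_add intro: polys_over_closed, auto simp: polys_over_def)

text \<open>A monomial with one exponent above m has total degree above m. This is what lets the
  diagonal descend to cohomology.\<close>

lemma diag_poly_trunc:
  assumes "p \<in> trunc_polys s m"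
  shows "diag_poly p \<in> trunc_polys 1 m"
proof (induction p rule: poly2_induct)
  case (monom a)
  then obtain i where "m < Poly_Mapping.lookup a i"
    using assms by (auto simp: trunc_polys_def)
  then have "m < total_deg a"
    using lookup_le_total_deg [of a i] by linarith
  then show ?case
    by (auto simp: trunc_polys_def)
qed (auto simp: diag_poly_add intro: trunc_polys_add)

text \<open>\<open>diff_ideal_power s m n\<close> is $I^n + J$, where $I$ is generated by the $x_i + x_1$ and $J$
  consists of the polynomials that vanish in cohomology. Taking $x_1$ as the base variable
  makes the diagonal an endomorphism \<open>diag_poly\<close> of the polynomial ring with \<open>p + diag_poly p \<in> I\<close>.\<close>

inductive_set diff_ideal_power :: "nat \<Rightarrow> nat \<Rightarrow> nat \<Rightarrow> poly2 set" for s m n where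
  trunc: "p \<in> trunc_polys s m \<Longrightarrow> p \<in> diff_ideal_power s m n"
| add: "p \<in> diff_ideal_power s m n \<Longrightarrow> q \<in> diff_ideal_power s m n \<Longrightarrow> p + q \<in> diff_ideal_power s m n"
| gen: "(\<Sum>i\<in>{1..s}. f i) = n \<Longrightarrow> f 1 = 0 \<Longrightarrow>
    c * (\<Prod>i\<in>{1..s}. (indet i + indet 1) ^ f i) \<in> diff_ideal_power s m n"

text \<open>A product of two generators is a generator whose exponent function is the sum of theirs,
  and a truncated factor absorbs the other one.\<close>

lemma diff_ideal_power_mult:
  assumes "p \<in> diff_ideal_power s m n" "q \<in> diff_ideal_power s m k"
  shows "p * q \<in> diff_ideal_power s m (n + k)"
  using assms(1)
proof induction
  case (trunc p)
  then show ?case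
    by (metis diff_ideal_power.trunc trunc_polys_mult mult.commute)
next
  case (add p q)
  then show ?case
    by (simp add: distrib_right diff_ideal_power.add)
next
  case (gen f c)
  from assms(2) show ?case
  proof induction
    case (trunc p)
    then show ?case
      by (metis diff_ideal_power.trunc trunc_polys_mult)
  next
    case (add p q)
    then show ?case
      by (simp add: distrib_left diff_ideal_power.add)
  next
    case (gen g d)
    have "(c * d) * (\<Prod>i\<in>{1..s}. (indet i + indet 1) ^ (f i + g i)) \<in> diff_ideal_power s m (n + k)"
      using gen \<open>sum f {1..s} = n\<close> \<open>f 1 = 0\<close>
      by (intro diff_ideal_power.gen) (auto simp: sum.distrib)
    then show ?case
      by (simp add: power_add prod.distrib mult_ac)
  qed
qed

lemma diff_ideal_power_prod:
  "(\<And>j. j < n \<Longrightarrow> g j \<in> diff_ideal_power s m 1) \<Longrightarrow> prod g {..<n} \<in> diff_ideal_power s m n"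
proof (induction n)
  case 0
  show ?case
    using diff_ideal_power.gen [where f = "\<lambda>_. 0" and s = s and n = 0 and m = m and c = 1] by simp
next
  case (Suc n)
  then show ?case
    using diff_ideal_power_mult [of "prod g {..<n}" s m n "g n" 1] by (simp add: mult.commute)
qed

lemma diff_ideal_mult:
  assumes "p \<in> diff_ideal_power s m n"
  shows "q * p \<in> diff_ideal_power s m n"
  using assms
proof induction
  case (gen f c)
  then show ?case
    using diff_ideal_power.gen [where f = f and s = s and n = n and m = m and c = "q * c"] by (simp add: mult.assoc)
qed (auto simp: distrib_left intro: diff_ideal_power.intros trunc_polys_mult)

lemma indet_diff_in_ideal:
  assumes "i \<in> {1..s}"
  shows "indet i + indet 1 \<in> diff_ideal_power s m 1"
proof (cases "i = 1")
  case True
  then show ?thesis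
    by (simp add: poly2_add_self diff_ideal_power.trunc)
next
  case False
  have *: "(indet j + indet 1) ^ (if j = i then 1 else 0)
      = (if j = i then indet i + indet 1 else 1)" for j
    by simp
  have "1 * (\<Prod>j\<in>{1..s}. (indet j + indet 1) ^ (if j = i then 1 else 0)) \<in> diff_ideal_power s m 1"
    using False assms by (intro diff_ideal_power.gen) auto
  then show ?thesis
    using assms unfolding * by (simp add: prod.delta)
qed

text \<open>Induction along ring generators: monomials are built one variable at a time, by
  induction on the total degree. It suits statements about ring homomorphisms, which are known on
  the variables only.\<close>

lemma polys_over_induct [consumes 1, case_names zero one add mult]:
  assumes "p \<in> polys_over V" and "P 0" "P 1"
    and add: "\<And>p q. p \<in> polys_over V \<Longrightarrow> q \<in> polys_over V \<Longrightarrow> P p \<Longrightarrow> P q \<Longrightarrow> P (p + q)"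
    and mult: "\<And>i p. i \<in> V \<Longrightarrow> p \<in> polys_over V \<Longrightarrow> P p \<Longrightarrow> P (indet i * p)"
  shows "P p"
proof -
  have single: "Poly_Mapping.single a 1 \<in> polys_over V \<and> P (Poly_Mapping.single a 1)"
    if "Poly_Mapping.keys a \<subseteq> V" for a
    using that
  proof (induction "total_deg a" arbitrary: a)
    case 0
    then have "a = 0"
      using lookup_le_total_deg [of a] by (intro poly_mapping_eqI) (metis le_zero_eq lookup_zero)
    then show ?case
      using \<open>P 1\<close> polys_over_closed(2) by simp
  next
    case (Suc n)
    then obtain i where i: "i \<in> Poly_Mapping.keys a"
      unfolding total_deg_def by (metis all_not_in_conv nat.distinct(1) sum.empty)
    define b where "b = a - Poly_Mapping.single i 1"
    have a: "a = Poly_Mapping.single i 1 + b"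
      using i unfolding b_def
      by (intro poly_mapping_eqI) (auto simp: lookup_add lookup_minus lookup_single when_def in_keys_iff)
    have "Poly_Mapping.single b 1 \<in> polys_over V \<and> P (Poly_Mapping.single b 1)"
      using Suc(2,3) by (intro Suc(1)) (auto simp: a total_deg_add keys_plus_nat)
    moreover have "Poly_Mapping.single a 1 = indet i * Poly_Mapping.single b 1"
      by (simp add: a indet_def mult_single)
    ultimately show ?case
      using i Suc(3) mult polys_over_closed(4,5) by (metis subsetD)
  qed
  have "p \<in> polys_over V \<and> P p"
  proof (induction p rule: poly2_induct)
    case (monom a)
    then show ?case
      using assms(1) by (intro single) (auto simp: polys_over_def)
  qed (auto intro: assms polys_over_closed)
  then show ?thesis ..
qed

text \<open>Modulo the sums x_i + x_1 every polynomial agrees with its image under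
  \<open>diag_poly\<close>. If that image is truncated, adding it back leaves p in I + J.\<close>

lemma diag_kernel_in_ideal:
  assumes "p \<in> polys_over {1..s}" "diag_poly p \<in> trunc_polys 1 m" "1 \<le> s"
  shows "p \<in> diff_ideal_power s m 1"
proof -
  from assms(1) have "p + diag_poly p \<in> diff_ideal_power s m 1"
  proof (induction p rule: polys_over_induct)
    case zero
    show ?case by (simp add: diff_ideal_power.trunc)
  next
    case one
    show ?case by (simp add: poly2_add_self diff_ideal_power.trunc)
  next
    case (add f g)
    have "(f + diag_poly f) + (g + diag_poly g) \<in> diff_ideal_power s m 1"
      using add(3,4) by (rule diff_ideal_power.add)
    then show ?case
      by (simp add: diag_poly_add add_ac)
  next
    case (mult i p)
    \<comment> \<open>Telescoping: the mixed term \<open>indet i * diag_poly p\<close> occurs twice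
      and cancels in characteristic 2, which leaves \<open>indet i * p\<close> plus its diagonal
      image.\<close>
    have "indet i * (p + diag_poly p) + diag_poly p * (indet i + indet 1) \<in> diff_ideal_power s m 1"
      by (rule diff_ideal_power.add [OF diff_ideal_mult [OF mult(3)]
            diff_ideal_mult [OF indet_diff_in_ideal [OF mult(1)]]])
    moreover have "indet i * (p + diag_poly p) + diag_poly p * (indet i + indet 1)
      = indet i * p + indet 1 * diag_poly p + (indet i * diag_poly p + indet i * diag_poly p)"
      by (simp only: algebra_simps)
    ultimately show ?case
      by (simp add: diag_poly_mult poly2_add_self)
  qed
  moreover have "diag_poly p \<in> diff_ideal_power s m 1"
    \<comment> \<open>Since 1 \<le> s, the base variable is among the truncated ones.\<close>
    using assms by (intro diff_ideal_power.trunc) (force simp: trunc_polys_def)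
  ultimately have "p + diag_poly p + diag_poly p \<in> diff_ideal_power s m 1"
    by (rule diff_ideal_power.add)
  then show ?thesis
    by (simp add: add.assoc poly2_add_self)
qed

section \<open>Non-vanishing of products of the sums of two generators\<close>

lemma frobenius_power: "(p + q) ^ (2 ^ e) = p ^ (2 ^ e) + q ^ (2 ^ e)" for p q :: poly2
proof (induction e)
  case (Suc e)
  have sq: "(u + v)\<^sup>2 = u\<^sup>2 + v\<^sup>2" for u v :: poly2
  proof -
    have "(u + v)\<^sup>2 = u\<^sup>2 + v\<^sup>2 + (u * v + u * v)"
      by (simp only: power2_eq_square algebra_simps)
    then show ?thesis
      by (simp add: poly2_add_self)
  qed
  have "(p + q) ^ (2 ^ Suc e) = ((p + q) ^ (2 ^ e))\<^sup>2"
    by (simp add: power_mult [symmetric] mult.commute)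
  also have "\<dots> = (p ^ (2 ^ e))\<^sup>2 + (q ^ (2 ^ e))\<^sup>2"
    by (simp only: Suc sq)
  also have "\<dots> = p ^ (2 ^ Suc e) + q ^ (2 ^ Suc e)"
    by (simp add: power_mult [symmetric] mult.commute)
  finally show ?case .
qed simp

text \<open>Polynomials in the E-th powers of the variables, homogeneous of degree k in these
  powers, where the degree counts x_1, ..., x_s only. It is applied with E = 2^e.\<close>

definition scaled_homogeneous :: "nat \<Rightarrow> nat \<Rightarrow> nat \<Rightarrow> poly2 set" where
  "scaled_homogeneous s E k = {p. \<forall>a\<in>Poly_Mapping.keys p.
     (\<forall>i. E dvd Poly_Mapping.lookup a i) \<and> (\<Sum>i\<in>{1..s}. Poly_Mapping.lookup a i) = E * k}"

lemma scaled_homogeneous_one: "1 \<in> scaled_homogeneous s E 0"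
  by (simp add: scaled_homogeneous_def)

lemma scaled_homogeneous_mult:
  assumes "p \<in> scaled_homogeneous s E k" "q \<in> scaled_homogeneous s E l"
  shows "p * q \<in> scaled_homogeneous s E (k + l)"
  unfolding scaled_homogeneous_def
proof (intro CollectI ballI)
  fix a
  assume "a \<in> Poly_Mapping.keys (p * q)"
  then obtain b c where "b \<in> Poly_Mapping.keys p" "c \<in> Poly_Mapping.keys q" "a = b + c"
    by (rule keys_multE)
  with assms show "(\<forall>i. E dvd Poly_Mapping.lookup a i) \<and>
      (\<Sum>i\<in>{1..s}. Poly_Mapping.lookup a i) = E * (k + l)"
    by (auto simp: scaled_homogeneous_def lookup_add sum.distrib distrib_left)
qed

lemma scaled_homogeneous_power:
  "p \<in> scaled_homogeneous s E k \<Longrightarrow> p ^ n \<in> scaled_homogeneous s E (n * k)"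
  by (induction n) (auto intro: scaled_homogeneous_mult scaled_homogeneous_one)

lemma scaled_homogeneous_prod:
  "(\<And>i. i \<in> I \<Longrightarrow> f i \<in> scaled_homogeneous s E (g i)) \<Longrightarrow>
   prod f I \<in> scaled_homogeneous s E (sum g I)"
  by (induction I rule: infinite_finite_induct)
    (auto intro: scaled_homogeneous_mult scaled_homogeneous_one)

lemma scaled_homogeneous_indet:
  assumes "i \<in> {1..s}" "j \<in> {1..s}"
  shows "indet i ^ E + indet j ^ E \<in> scaled_homogeneous s E 1"
proof -
  have "indet i ^ E \<in> scaled_homogeneous s E 1" if "i \<in> {1..s}" for i
    using that by (auto simp: scaled_homogeneous_def indet_power lookup_single when_def)
  then show ?thesis
    using assms keys_add [of "indet i ^ E" "indet j ^ E"]
    unfolding scaled_homogeneous_def by blast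
qed

text \<open>Pigeonhole: a multiple of E that is at most m = EM - 1 is at most E(M - 1). If all s
  exponents were that small, their sum could not reach Ek.\<close>

lemma scaled_homogeneous_trunc:
  assumes "s * (M - 1) < k" "m + 1 = E * M"
  shows "scaled_homogeneous s E k \<subseteq> trunc_polys s m"
proof
  fix p
  assume p: "p \<in> scaled_homogeneous s E k"
  have "\<exists>i\<in>{1..s}. m < Poly_Mapping.lookup a i" if a: "a \<in> Poly_Mapping.keys p" for a
  proof (rule ccontr)
    assume "\<not> ?thesis"
    then have small: "Poly_Mapping.lookup a i \<le> m" if "i \<in> {1..s}" for i
      using that by (meson not_less)
    have "Poly_Mapping.lookup a i \<le> E * (M - 1)" if i: "i \<in> {1..s}" for i
    proof -
      have "E dvd Poly_Mapping.lookup a i"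
        using p a by (auto simp: scaled_homogeneous_def)
      then obtain c where c: "Poly_Mapping.lookup a i = E * c" ..
      then have "E * c < E * M"
        using small [OF i] assms(2) by linarith
      then have "c < M"
        by (metis mult_less_cancel1)
      then have "c \<le> M - 1"
        by simp
      then show ?thesis
        using c by simp
    qed
    then have "(\<Sum>i\<in>{1..s}. Poly_Mapping.lookup a i) \<le> s * (E * (M - 1))"
      using sum_bounded_above [of "{1..s}" "Poly_Mapping.lookup a" "E * (M - 1)"] by simp
    also have "\<dots> = E * (s * (M - 1))"
      by simp
    also have "\<dots> < E * k"
      using assms by (metis Suc_eq_plus1 mult_less_cancel1 mult_0 nat.distinct(1) neq0_conv)
    finally show False
      using p a by (auto simp: scaled_homogeneous_def)
  qed
  then show "p \<in> trunc_polys s m"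
    by (simp add: trunc_polys_def)
qed

text \<open>Splitting off the largest multiple of $2^e$ from every exponent leaves a polynomial in
  the $x_i^{2^e}$ of degree greater than $s(M-1)$, while $x_i^{2^e M} = 0$ in cohomology.\<close>

lemma diff_product_trunc:
  assumes "m + 1 = 2 ^ e * M" "1 \<le> s" "f 1 = 0" "s * m < sum f {1..s} + (2 ^ e - 1)"
  shows "c * (\<Prod>i\<in>{1..s}. (indet i + indet 1) ^ f i) \<in> trunc_polys s m"
proof -
  define E :: nat where "E = 2 ^ e"
  have E: "0 < E" and M: "0 < M"
    using assms(1) by (auto simp: E_def intro: ccontr)
  let ?q = "\<lambda>i. f i div E" and ?r = "\<lambda>i. f i mod E"
  have split: "(indet i + indet 1) ^ f i
      = (indet i + indet 1) ^ ?r i * (indet i ^ E + indet 1 ^ E) ^ ?q i" for i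
  proof -
    have "(indet i + indet 1) ^ f i = (indet i + indet 1) ^ (?r i + E * ?q i)"
      by simp
    also have "\<dots> = (indet i + indet 1) ^ ?r i * ((indet i + indet 1) ^ E) ^ ?q i"
      by (simp only: power_add power_mult)
    finally show ?thesis
      by (simp only: E_def frobenius_power)
  qed
  have "(\<Prod>i\<in>{1..s}. (indet i ^ E + indet 1 ^ E) ^ ?q i) \<in> scaled_homogeneous s E (sum ?q {1..s})"
  proof (rule scaled_homogeneous_prod)
    fix i
    assume "i \<in> {1..s}"
    then show "(indet i ^ E + indet 1 ^ E) ^ ?q i \<in> scaled_homogeneous s E (?q i)"
      using scaled_homogeneous_power [OF scaled_homogeneous_indet [of i s 1 E], of "?q i"] assms(2)
      by simp
  qed
  moreover have "s * (M - 1) < sum ?q {1..s}"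
  proof -
    \<comment> \<open>Because f 1 = 0, only s - 1 remainders count, each at most E - 1. Together
      with the slack E - 1 of the hypothesis they give s(E - 1), which is exactly the part of sm =
      sE(M - 1) + s(E - 1) that has to cancel.\<close>
    have "sum ?r {1..s} \<le> (s - 1) * (E - 1)"
    proof -
      have "sum ?r {1..s} = sum ?r {2..s}"
        using assms(2,3) by (simp add: sum.atLeast_Suc_atMost numeral_2_eq_2)
      also have "\<dots> \<le> of_nat (card {2..s}) * (E - 1)"
        using E by (intro sum_bounded_above) (simp add: less_Suc_eq_le [symmetric])
      finally show ?thesis
        by simp
    qed
    moreover have "sum f {1..s} = E * sum ?q {1..s} + sum ?r {1..s}"
      by (simp add: sum_distrib_left sum.distrib [symmetric])
    ultimately have "s * m < E * sum ?q {1..s} + (s - 1) * (E - 1) + (E - 1)"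
      using assms(4) unfolding E_def [symmetric] by linarith
    also have "\<dots> = E * sum ?q {1..s} + s * (E - 1)"
      using assms(2) by (cases s) auto
    finally have "s * m < E * sum ?q {1..s} + s * (E - 1)" .
    moreover have "s * m = s * (E * (M - 1)) + s * (E - 1)"
    proof -
      have "m = E * (M - 1) + (E - 1)"
        using assms(1) E M unfolding E_def [symmetric] by (cases M; cases E) auto
      then show ?thesis
        by (metis distrib_left)
    qed
    ultimately have "E * (s * (M - 1)) < E * sum ?q {1..s}"
      by (simp add: mult.left_commute)
    then show ?thesis
      by simp
  qed
  ultimately have *: "(\<Prod>i\<in>{1..s}. (indet i ^ E + indet 1 ^ E) ^ ?q i) \<in> trunc_polys s m"
    using scaled_homogeneous_trunc [of s M _ m E] assms(1) E_def by blast
  show ?thesis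
    unfolding split prod.distrib mult.assoc [symmetric] by (rule trunc_polys_mult [OF *])
qed

lemma diff_ideal_power_trunc:
  assumes "m + 1 = 2 ^ e * M" "1 \<le> s" "s * m < n + (2 ^ e - 1)"
  shows "diff_ideal_power s m n \<subseteq> trunc_polys s m"
proof
  fix p
  assume "p \<in> diff_ideal_power s m n"
  then show "p \<in> trunc_polys s m"
  proof induction
    case (gen f c)
    then show ?case
      using assms by (intro diff_product_trunc) simp_all
  qed (auto intro: trunc_polys_add)
qed

section \<open>Lower bound: a monomial that survives truncation\<close>

lemma lookup_single_mult_add:
  "Poly_Mapping.lookup (Poly_Mapping.single b c * p) (b + k) = c * Poly_Mapping.lookup p k"
  for b :: "'a::cancel_comm_monoid_add" and c :: "'b::semiring_0"
  by (simp add: lookup_mult lookup_single when_mult)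

text \<open>For j in A the variable x_j occurs in the j-th factor only, so that factor must
  contribute x_j^m and hence x_1^(d j), with a binomial coefficient. The powers of x_1 accumulate to
  the exponent \<open>sum d A\<close>.\<close>

lemma lookup_diff_product:
  assumes "finite A" "1 \<notin> A"
  shows "Poly_Mapping.lookup (\<Prod>i\<in>A. (indet i + indet 1) ^ (m + d i))
      ((\<Sum>i\<in>A. Poly_Mapping.single i m) + Poly_Mapping.single 1 (sum d A))
    = (\<Prod>i\<in>A. of_nat ((m + d i) choose m))"
  using assms
proof (induction A rule: finite_induct)
  case empty
  then show ?case by simp
next
  case (insert j A)
  let ?P = "\<Prod>i\<in>A. (indet i + indet 1) ^ (m + d i)"
  let ?a = "(\<Sum>i\<in>A. Poly_Mapping.single i m) + Poly_Mapping.single 1 (sum d A)"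
  let ?b = "\<lambda>k. Poly_Mapping.single j k + Poly_Mapping.single 1 (m + d j - k)"
  have "?P \<in> polys_over (insert 1 A)"
    by (auto intro!: polys_over_prod polys_over_power polys_over_closed)
  moreover have "j \<notin> insert 1 A"
    using insert.hyps insert.prems by auto
  ultimately have no_j: "Poly_Mapping.lookup a j = 0" if "a \<in> Poly_Mapping.keys ?P" for a
    using that unfolding polys_over_def by (metis (mono_tags, lifting) in_keys_iff mem_Collect_eq subsetD)
  have aj: "Poly_Mapping.lookup ?a j = 0"
    using insert.hyps insert.prems by (auto simp: lookup_add lookup_sum lookup_single when_def)
  have key: "(\<Sum>i\<in>insert j A. Poly_Mapping.single i m) + Poly_Mapping.single 1 (sum d (insert j A))
      = ?b m + ?a"
    using insert.hyps by (simp add: single_add add_ac)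
  have expand: "(indet j + indet 1) ^ (m + d j)
      = (\<Sum>k\<le>m + d j. Poly_Mapping.single (?b k) (of_nat ((m + d j) choose k)))"
    unfolding binomial_ring
  proof (rule sum.cong [OF refl])
    fix k
    show "of_nat ((m + d j) choose k) * indet j ^ k * indet 1 ^ (m + d j - k)
      = Poly_Mapping.single (?b k) (of_nat ((m + d j) choose k))"
      unfolding indet_power single_of_nat [symmetric] mult_single by simp
  qed
  \<comment> \<open>Neither \<open>?P\<close> nor \<open>?a\<close> involves x_j, so comparing
    exponents of x_j rules out every term of the binomial expansion except k = m.\<close>
  have coeff: "Poly_Mapping.lookup
      (Poly_Mapping.single (?b k) (of_nat ((m + d j) choose k)) * ?P) (?b m + ?a)
    = (if k = m then of_nat ((m + d j) choose m) * Poly_Mapping.lookup ?P ?a else 0)" for k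
  proof (cases "k = m")
    case True
    then show ?thesis
      by (simp only: lookup_single_mult_add if_True simp_thms)
  next
    case False
    have "?b m + ?a \<notin> Poly_Mapping.keys
        (Poly_Mapping.single (?b k) (of_nat ((m + d j) choose k)) * ?P)"
    proof
      assume "?b m + ?a \<in> Poly_Mapping.keys
        (Poly_Mapping.single (?b k) (of_nat ((m + d j) choose k)) * ?P)"
      then obtain b c where "b \<in> Poly_Mapping.keys
          (Poly_Mapping.single (?b k) (of_nat ((m + d j) choose k) :: bit))"
        and c: "c \<in> Poly_Mapping.keys ?P" and eq: "?b m + ?a = b + c"
        by (rule keys_multE)
      then have b: "b = ?b k"
        by (auto split: if_splits)
      have "1 \<noteq> j"
        using insert.prems by auto
      moreover have "Poly_Mapping.lookup (?b m + ?a) j = Poly_Mapping.lookup (?b k + c) j"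
        using eq b by simp
      ultimately show False
        using no_j [OF c] aj False by (simp add: lookup_add lookup_single when_def)
    qed
    then show ?thesis
      using False by (simp add: in_keys_iff)
  qed
  have "Poly_Mapping.lookup (\<Prod>i\<in>insert j A. (indet i + indet 1) ^ (m + d i)) (?b m + ?a)
    = (\<Sum>k\<le>m + d j. if k = m then of_nat ((m + d j) choose m) * Poly_Mapping.lookup ?P ?a else 0)"
    unfolding prod.insert [OF insert(1,2)] expand sum_distrib_right lookup_sum coeff ..
  also have "\<dots> = of_nat ((m + d j) choose m) * Poly_Mapping.lookup ?P ?a"
    by simp
  also have "\<dots> = (\<Prod>i\<in>insert j A. of_nat ((m + d i) choose m))"
  proof -
    have "Poly_Mapping.lookup ?P ?a = (\<Prod>i\<in>A. of_nat ((m + d i) choose m))"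
      using insert.prems by (intro insert.IH) simp
    then show ?thesis
      by (simp only: prod.insert [OF insert.hyps])
  qed
  finally show ?case
    unfolding key .
qed

lemma of_nat_bit_odd: "odd n \<Longrightarrow> (of_nat n :: bit) = 1"
  by (auto elim!: oddE)

text \<open>The monomial of \<open>lookup_diff_product\<close> has as coefficient a product of odd
  numbers, and the bound on \<open>sum d {2..s}\<close> keeps its exponent of x_1 at most m.\<close>

lemma diff_product_not_trunc:
  assumes "\<And>i. i \<in> {2..s} \<Longrightarrow> odd ((m + d i) choose m)" "sum d {2..s} \<le> m"
  shows "(\<Prod>i\<in>{2..s}. (indet i + indet 1) ^ (m + d i)) \<notin> trunc_polys s m"
proof
  let ?P = "\<Prod>i\<in>{2..s}. (indet i + indet 1) ^ (m + d i)"
  let ?a = "(\<Sum>i\<in>{2..s}. Poly_Mapping.single i m) + Poly_Mapping.single 1 (sum d {2..s})"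
  assume P: "?P \<in> trunc_polys s m"
  have "Poly_Mapping.lookup ?P ?a = (\<Prod>i\<in>{2..s}. of_nat ((m + d i) choose m))"
    by (rule lookup_diff_product) auto
  also have "\<dots> = (\<Prod>i\<in>{2..s}. 1)"
    by (intro prod.cong refl of_nat_bit_odd assms(1))
  finally have "?a \<in> Poly_Mapping.keys ?P"
    by (simp add: in_keys_iff)
  with P obtain i where "i \<in> {1..s}" "m < Poly_Mapping.lookup ?a i"
    unfolding trunc_polys_def by blast
  then show False
    using assms(2) by (auto simp: lookup_add lookup_sum lookup_single when_def split: if_splits)
qed

section \<open>The cohomology ring and the diagonal\<close>

lemma mpoly2_simps:
  "carrier (mpoly2 s) = polys_over {1..s}" "p \<otimes>\<^bsub>mpoly2 s\<^esub> q = p * q"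
  "p \<oplus>\<^bsub>mpoly2 s\<^esub> q = p + q" "\<one>\<^bsub>mpoly2 s\<^esub> = 1" "\<zero>\<^bsub>mpoly2 s\<^esub> = 0"
  by (simp_all add: mpoly2_def polys_over_def)

lemma cring_mpoly2: "cring (mpoly2 s)"
proof (rule cringI)
  show "abelian_group (mpoly2 s)"
  proof (rule abelian_groupI)
    fix p
    assume "p \<in> carrier (mpoly2 s)"
    then show "\<exists>q\<in>carrier (mpoly2 s). q \<oplus>\<^bsub>mpoly2 s\<^esub> p = \<zero>\<^bsub>mpoly2 s\<^esub>"
      unfolding mpoly2_simps by (intro bexI [of _ p] poly2_add_self)
  qed (auto simp: mpoly2_simps add_ac intro: polys_over_closed)
  show "Group.comm_monoid (mpoly2 s)"
    by (rule comm_monoidI) (auto simp: mpoly2_simps mult_ac intro: polys_over_closed)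
qed (auto simp: mpoly2_simps distrib_right)

text \<open>The right-hand side is an ideal containing the generators. Conversely, a monomial with
  exponent of x_i above m is a multiple of x_i^(m+1), and sums of such monomials stay in the ideal.
  Vanishing in cohomology thus becomes a condition on exponents.\<close>

lemma trunc_ideal_eq: "trunc_ideal s m = polys_over {1..s} \<inter> trunc_polys s m"
  and ideal_trunc_ideal: "ideal (trunc_ideal s m) (mpoly2 s)"
proof -
  interpret R: cring "mpoly2 s"
    by (rule cring_mpoly2)
  let ?G = "(\<lambda>i. indet i ^ (m + 1)) ` {1..s}"
  let ?J = "polys_over {1..s} \<inter> trunc_polys s m"
  have G: "?G \<subseteq> carrier (mpoly2 s)"
    unfolding mpoly2_simps using polys_over_power polys_over_closed(5) by blast
  have J: "ideal ?J (mpoly2 s)"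
  proof (rule idealI)
    show "subgroup ?J (add_monoid (mpoly2 s))"
    proof (rule R.add.subgroupI)
      show "?J \<noteq> {}"
        using polys_over_closed(1) trunc_polys_zero by blast
      show "\<ominus>\<^bsub>mpoly2 s\<^esub> p \<in> ?J" if "p \<in> ?J" for p
      proof -
        have "\<ominus>\<^bsub>mpoly2 s\<^esub> p = p"
          using that by (intro R.minus_equality) (auto simp: mpoly2_simps poly2_add_self)
        then show ?thesis
          using that by simp
      qed
    qed (auto simp: mpoly2_simps intro: polys_over_closed trunc_polys_add)
    show "q \<otimes>\<^bsub>mpoly2 s\<^esub> p \<in> ?J" "p \<otimes>\<^bsub>mpoly2 s\<^esub> q \<in> ?J" if "p \<in> ?J" "q \<in> carrier (mpoly2 s)" for p q
      using that by (auto simp: mpoly2_simps mult.commute [of p] intro: polys_over_closed trunc_polys_mult)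
  qed (rule R.ring_axioms)
  show ideal: "ideal (trunc_ideal s m) (mpoly2 s)"
    unfolding trunc_ideal_def by (rule R.genideal_ideal [OF G])
  show "trunc_ideal s m = ?J"
  proof
    have "?G \<subseteq> ?J"
    proof
      fix p
      assume "p \<in> ?G"
      then obtain i where "i \<in> {1..s}" "p = indet i ^ (m + 1)"
        by blast
      then show "p \<in> ?J"
        unfolding indet_power by (auto simp: polys_over_def trunc_polys_def intro!: bexI [of _ i])
    qed
    then show "trunc_ideal s m \<subseteq> ?J"
      unfolding trunc_ideal_def by (rule R.genideal_minimal [OF J])
  next
    interpret I: ideal "trunc_ideal s m" "mpoly2 s"
      by (rule ideal)
    show "?J \<subseteq> trunc_ideal s m"
    proof
      fix p
      assume p: "p \<in> ?J"
      show "p \<in> trunc_ideal s m"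
      proof (induction p rule: poly2_induct)
        case zero
        show ?case
          using I.zero_closed by (simp add: mpoly2_simps)
      next
        case (add f g)
        then show ?case
          using I.a_closed by (simp add: mpoly2_simps)
      next
        case (monom a)
        then obtain i where i: "i \<in> {1..s}" "m < Poly_Mapping.lookup a i"
          using p by (auto simp: trunc_polys_def)
        have a: "Poly_Mapping.keys a \<subseteq> {1..s}"
          using p monom by (auto simp: polys_over_def)
        define b where "b = a - Poly_Mapping.single i (m + 1)"
        have "a = b + Poly_Mapping.single i (m + 1)"
          unfolding b_def using i
          by (intro poly_mapping_eqI) (auto simp: lookup_add lookup_minus lookup_single when_def)
        then have eq: "Poly_Mapping.single a 1 = Poly_Mapping.single b 1 * indet i ^ (m + 1)"
          and "Poly_Mapping.keys b \<subseteq> {1..s}"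
          using a unfolding indet_power mult_single by (auto simp: keys_plus_nat)
        then have "Poly_Mapping.single b 1 \<in> carrier (mpoly2 s)"
          by (simp add: mpoly2_simps polys_over_def)
        moreover have "indet i ^ (m + 1) \<in> trunc_ideal s m"
          unfolding trunc_ideal_def using R.genideal_self [OF G] i(1) by blast
        ultimately show ?case
          unfolding eq using I.I_l_closed by (simp only: mpoly2_simps)
      qed
    qed
  qed
qed

section \<open>Cohomology classes as cosets of polynomials\<close>

definition coset :: "nat \<Rightarrow> nat \<Rightarrow> poly2 \<Rightarrow> poly2 set" where
  "coset s m p = trunc_ideal s m +>\<^bsub>mpoly2 s\<^esub> p"

lemma cring_cohom_RP: "cring (cohom_RP s m)"
  unfolding cohom_RP_def by (rule ideal.quotient_is_cring [OF ideal_trunc_ideal cring_mpoly2])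

lemma coset_hom: "coset s m \<in> ring_hom (mpoly2 s) (cohom_RP s m)"
  unfolding cohom_RP_def coset_def [abs_def] by (rule ideal.rcos_ring_hom [OF ideal_trunc_ideal])

lemma carrier_cohom_RP: "carrier (cohom_RP s m) = coset s m ` polys_over {1..s}"
  by (auto simp: cohom_RP_def FactRing_def A_RCOSETS_def' coset_def mpoly2_simps)

lemma coset_closed: "p \<in> polys_over {1..s} \<Longrightarrow> coset s m p \<in> carrier (cohom_RP s m)"
  by (simp add: carrier_cohom_RP)

lemma coset_add:
  "p \<in> polys_over {1..s} \<Longrightarrow> q \<in> polys_over {1..s} \<Longrightarrow>
   coset s m (p + q) = coset s m p \<oplus>\<^bsub>cohom_RP s m\<^esub> coset s m q"
  using ring_hom_add [OF coset_hom, of p s q m] by (simp add: mpoly2_simps)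

lemma coset_mult:
  "p \<in> polys_over {1..s} \<Longrightarrow> q \<in> polys_over {1..s} \<Longrightarrow>
   coset s m (p * q) = coset s m p \<otimes>\<^bsub>cohom_RP s m\<^esub> coset s m q"
  using ring_hom_mult [OF coset_hom, of p s q m] by (simp add: mpoly2_simps)

lemma coset_one: "coset s m 1 = \<one>\<^bsub>cohom_RP s m\<^esub>"
  using ring_hom_one [OF coset_hom, of s m] by (simp add: mpoly2_simps)

lemma coset_eq_zero_iff:
  assumes "p \<in> polys_over {1..s}"
  shows "coset s m p = \<zero>\<^bsub>cohom_RP s m\<^esub> \<longleftrightarrow> p \<in> trunc_polys s m"
proof -
  interpret I: ideal "trunc_ideal s m" "mpoly2 s"
    by (rule ideal_trunc_ideal)
  have p: "p \<in> carrier (mpoly2 s)"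
    using assms by (simp add: mpoly2_simps)
  have "coset s m p = \<zero>\<^bsub>cohom_RP s m\<^esub> \<longleftrightarrow> coset s m p = trunc_ideal s m"
    by (simp add: cohom_RP_def FactRing_def)
  also have "\<dots> \<longleftrightarrow> p \<in> trunc_ideal s m"
    unfolding coset_def using I.a_rcos_const I.a_rcos_self [OF p] by blast
  finally show ?thesis
    using assms by (simp add: trunc_ideal_eq)
qed

lemma coset_zero: "coset s m 0 = \<zero>\<^bsub>cohom_RP s m\<^esub>"
  by (simp add: coset_eq_zero_iff polys_over_closed)

text \<open>In characteristic 2 the sum of two representatives is also their difference.\<close>

lemma coset_eq_iff:
  assumes "p \<in> polys_over {1..s}" "q \<in> polys_over {1..s}"
  shows "coset s m p = coset s m q \<longleftrightarrow> p + q \<in> trunc_polys s m"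
proof -
  interpret Q: cring "cohom_RP s m"
    by (rule cring_cohom_RP)
  note closed = coset_closed [OF assms(1), of m] coset_closed [OF assms(2), of m]
  have "coset s m p = coset s m q \<longleftrightarrow>
      coset s m p \<oplus>\<^bsub>cohom_RP s m\<^esub> coset s m q = coset s m q \<oplus>\<^bsub>cohom_RP s m\<^esub> coset s m q"
    using closed by (metis Q.add.right_cancel)
  also have "\<dots> \<longleftrightarrow> coset s m (p + q) = coset s m (q + q)"
    by (simp only: coset_add assms)
  finally show ?thesis
    using assms by (simp add: poly2_add_self coset_zero coset_eq_zero_iff polys_over_closed)
qed

lemma coset_prod:
  "(\<And>j. j < n \<Longrightarrow> g j \<in> polys_over {1..s}) \<Longrightarrow>
   coset s m (prod g {..<n}) = (\<Otimes>\<^bsub>cohom_RP s m\<^esub>j\<in>{..<n}. coset s m (g j))"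
  for n :: nat
proof (induction n)
  case 0
  interpret Q: cring "cohom_RP s m"
    by (rule cring_cohom_RP)
  show ?case
    by (simp add: coset_one)
next
  case (Suc n)
  interpret Q: cring "cohom_RP s m"
    by (rule cring_cohom_RP)
  have "prod g {..<n} \<in> polys_over {1..s}"
    using Suc.prems by (intro polys_over_prod) simp
  moreover have "(\<Otimes>\<^bsub>cohom_RP s m\<^esub>j\<in>insert n {..<n}. coset s m (g j))
      = coset s m (g n) \<otimes>\<^bsub>cohom_RP s m\<^esub> (\<Otimes>\<^bsub>cohom_RP s m\<^esub>j\<in>{..<n}. coset s m (g j))"
    using Suc.prems by (intro Q.finprod_insert) (auto intro: coset_closed)
  ultimately show ?case
    using Suc by (simp add: lessThan_Suc coset_mult)
qed

text \<open>\<open>diag_hom\<close> is a definite description, so this takes existence and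
  uniqueness of the homomorphism. It exists because \<open>diag_poly\<close> respects truncation; it
  is unique because its values on the generators determine it on the carrier, and extensionality
  does so elsewhere.\<close>

lemma diag_hom_coset:
  assumes "1 \<le> s" "p \<in> polys_over {1..s}"
  shows "diag_hom s m (coset s m p) = coset 1 m (diag_poly p)"
proof -
  let ?A = "cohom_RP s m" and ?B = "cohom_RP 1 m"
  have diag1: "diag_poly q \<in> polys_over {1..1}" for q
    by (rule diag_poly_polys_over) simp
  \<comment> \<open>The candidate evaluates \<open>diag_poly\<close> on a chosen representative; the
    next fact shows that the choice is immaterial.\<close>
  define h where "h = (\<lambda>X\<in>carrier ?A. coset 1 m (diag_poly (SOME q. q \<in> polys_over {1..s} \<and> coset s m q = X)))"
  have h: "h (coset s m q) = coset 1 m (diag_poly q)" if q: "q \<in> polys_over {1..s}" for q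
  proof -
    define r where "r = (SOME r. r \<in> polys_over {1..s} \<and> coset s m r = coset s m q)"
    have "r \<in> polys_over {1..s} \<and> coset s m r = coset s m q"
      unfolding r_def by (rule someI [of _ q]) (use q in blast)
    then have "diag_poly (r + q) \<in> trunc_polys 1 m"
      using q coset_eq_iff [of r s q m] by (intro diag_poly_trunc [where s = s]) blast
    then have "coset 1 m (diag_poly r) = coset 1 m (diag_poly q)"
      by (simp only: coset_eq_iff diag1 diag_poly_add)
    then show ?thesis
      using q by (simp add: h_def r_def coset_closed)
  qed
  have "diag_hom s m = h"
    unfolding diag_hom_def
  proof (rule the_equality)
    have "h \<in> ring_hom ?A ?B"
    proof (rule ring_hom_memI)
      fix x
      assume "x \<in> carrier ?A"
      then show "h x \<in> carrier ?B"
        using diag1 by (auto simp: carrier_cohom_RP h)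
    next
      fix x y
      assume "x \<in> carrier ?A" "y \<in> carrier ?A"
      then obtain p q where pq: "p \<in> polys_over {1..s}" "q \<in> polys_over {1..s}"
        and xy: "x = coset s m p" "y = coset s m q"
        unfolding carrier_cohom_RP by blast
      show "h (x \<otimes>\<^bsub>?A\<^esub> y) = h x \<otimes>\<^bsub>?B\<^esub> h y" "h (x \<oplus>\<^bsub>?A\<^esub> y) = h x \<oplus>\<^bsub>?B\<^esub> h y"
        unfolding xy coset_mult [OF pq, symmetric] coset_add [OF pq, symmetric] h [OF pq(1)] h [OF pq(2)]
          h [OF polys_over_closed(4) [OF pq]] h [OF polys_over_closed(3) [OF pq]] diag_poly_mult diag_poly_add
        by (rule coset_mult [OF diag1 diag1] coset_add [OF diag1 diag1])+
    next
      show "h \<one>\<^bsub>?A\<^esub> = \<one>\<^bsub>?B\<^esub>"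
        unfolding coset_one [symmetric] by (simp add: h polys_over_closed)
    qed
    moreover have "h (cohom_gen s m i) = cohom_gen 1 m 1" if "i \<in> {1..s}" for i
      using h [of "indet i"] that
      by (simp add: cohom_gen_def coset_def [symmetric] polys_over_closed)
    ultimately show "h \<in> ring_hom ?A ?B \<and> h \<in> extensional (carrier ?A) \<and>
        (\<forall>i\<in>{1..s}. h (cohom_gen s m i) = cohom_gen 1 m 1)"
      by (simp add: h_def)
  next
    fix f
    assume f: "f \<in> ring_hom ?A ?B \<and> f \<in> extensional (carrier ?A) \<and>
        (\<forall>i\<in>{1..s}. f (cohom_gen s m i) = cohom_gen 1 m 1)"
    interpret A: cring ?A by (rule cring_cohom_RP)
    interpret B: cring ?B by (rule cring_cohom_RP)
    interpret f: ring_hom_cring ?A ?B f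
      using f by unfold_locales auto
    have "f (coset s m q) = coset 1 m (diag_poly q)" if "q \<in> polys_over {1..s}" for q
      using that
    proof (induction q rule: polys_over_induct)
      case zero
      then show ?case by (simp add: coset_zero)
    next
      case one
      then show ?case by (simp add: coset_one)
    next
      case (add p q)
      then show ?case
        using diag1 by (simp add: coset_add coset_closed diag_poly_add)
    next
      case (mult i p)
      have "f (coset s m (indet i)) = coset 1 m (indet 1)"
        using f mult(1) by (simp add: cohom_gen_def coset_def)
      then show ?case
        using mult diag1 diag_poly_indet polys_over_closed(5)
        by (simp add: coset_mult coset_closed diag_poly_mult)
    qed
    then have "f x = h x" if "x \<in> carrier ?A" for x
      using that by (auto simp: carrier_cohom_RP h)
    then show "f = h"
      using f by (intro extensionalityI [of f "carrier ?A"]) (auto simp: h_def)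
  qed
  then show ?thesis
    using h assms(2) by simp
qed

text \<open>Classes in the kernel lift to polynomials with truncated diagonal image, and a product
  of classes is non-zero exactly when the product of the lifts is not truncated. From here on only
  polynomials are needed.\<close>

lemma zcl_RP_eq:
  assumes "1 \<le> s"
  shows "zcl_RP s m = Max {n. \<exists>g. (\<forall>j<n. g j \<in> polys_over {1..s} \<and> diag_poly (g j) \<in> trunc_polys 1 m)
    \<and> prod g {..<n} \<notin> trunc_polys s m}"
proof -
  let ?A = "cohom_RP s m" and ?B = "cohom_RP 1 m"
  let ?K = "{p \<in> polys_over {1..s}. diag_poly p \<in> trunc_polys 1 m}"
  have K: "a_kernel ?A ?B (diag_hom s m) = coset s m ` ?K"
  proof -
    have "diag_poly q \<in> polys_over {1..1}" for q
      by (rule diag_poly_polys_over) simp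
    then have "diag_hom s m (coset s m p) = \<zero>\<^bsub>?B\<^esub> \<longleftrightarrow> diag_poly p \<in> trunc_polys 1 m"
      if "p \<in> polys_over {1..s}" for p
      using that by (simp only: diag_hom_coset [OF assms] coset_eq_zero_iff)
    then show ?thesis
      by (auto simp: a_kernel_def' carrier_cohom_RP)
  qed
  have prod: "(\<Otimes>\<^bsub>?A\<^esub>j\<in>{..<n}. coset s m (g j)) \<noteq> \<zero>\<^bsub>?A\<^esub> \<longleftrightarrow> prod g {..<n} \<notin> trunc_polys s m"
    if "\<And>j. j < n \<Longrightarrow> g j \<in> polys_over {1..s}" for g and n :: nat
  proof -
    have "prod g {..<n} \<in> polys_over {1..s}"
      using that by (intro polys_over_prod) simp
    then show ?thesis
      using that by (simp add: coset_prod [symmetric] coset_eq_zero_iff)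
  qed
  interpret A: cring ?A by (rule cring_cohom_RP)
  have "(\<exists>u \<in> {..<n} \<rightarrow> a_kernel ?A ?B (diag_hom s m). (\<Otimes>\<^bsub>?A\<^esub>j\<in>{..<n}. u j) \<noteq> \<zero>\<^bsub>?A\<^esub>) \<longleftrightarrow>
    (\<exists>g. (\<forall>j<n. g j \<in> polys_over {1..s} \<and> diag_poly (g j) \<in> trunc_polys 1 m)
      \<and> prod g {..<n} \<notin> trunc_polys s m)" (is "?L \<longleftrightarrow> ?R") for n :: nat
  proof
    assume ?L
    then obtain u where u: "u \<in> {..<n} \<rightarrow> coset s m ` ?K"
      and nz: "(\<Otimes>\<^bsub>?A\<^esub>j\<in>{..<n}. u j) \<noteq> \<zero>\<^bsub>?A\<^esub>"
      unfolding K by blast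
    have "\<forall>j\<in>{..<n}. \<exists>p. p \<in> ?K \<and> u j = coset s m p"
      using u by blast
    then obtain g where g: "\<forall>j\<in>{..<n}. g j \<in> ?K \<and> u j = coset s m (g j)"
      by (rule bchoice [THEN exE])
    have "(\<Otimes>\<^bsub>?A\<^esub>j\<in>{..<n}. u j) = (\<Otimes>\<^bsub>?A\<^esub>j\<in>{..<n}. coset s m (g j))"
      using g by (intro A.finprod_cong') (auto intro: coset_closed)
    then have "prod g {..<n} \<notin> trunc_polys s m"
      using nz prod [of n g] g by simp
    then show ?R
      using g by blast
  next
    assume ?R
    then obtain g where "\<forall>j<n. g j \<in> ?K" "prod g {..<n} \<notin> trunc_polys s m"
      by blast
    then show ?L
      unfolding K using prod [of n g] by (intro bexI [of _ "\<lambda>j. coset s m (g j)"]) auto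
  qed
  then show ?thesis
    by (simp add: zcl_RP_def kernel_cup_length_def)
qed

section \<open>The greedy decomposition\<close>

text \<open>The last binary digit in Lucas' theorem modulo 2. Two applications of Pascal's rule to
  \<open>2 * n + 2\<close> mix both parities of the lower index, so the two claims share one
  induction.\<close>

lemma even_choose:
  shows "even (2 * n choose Suc (2 * k))" and "even (2 * n choose (2 * k)) = even (n choose k)"
proof (induction n arbitrary: k)
  case (Suc n)
  { case 1
    show ?case
      using Suc(2) [of k] Suc(1) [of k] Suc(1) [of "k - 1"] Suc(2) [of "k - 1"] by (cases k) simp_all
  next
    case 2
    show ?case
      using Suc(1) [of "k - 1"] Suc(2) [of "k - 1"] Suc(2) [of k] by (cases k) simp_all
  }
next
  case 0
  { case 1 show ?case by simp
  next case 2 show ?case by (cases k) auto }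
qed

lemma even_choose_odd: "even (Suc (2 * n) choose (2 * k)) = even (n choose k)"
proof (cases k)
  case (Suc j)
  then show ?thesis
    using even_choose [of n j] even_choose [of n k] by simp
qed simp

text \<open>Removing the last binary digit 1 of m and halving the power of 2 preserves the parity,
  until the coefficient is M choose 1 = M. Hence the last number d_t = 2^e of the recursion is
  always admissible.\<close>

lemma odd_choose_add_power2:
  assumes "odd M" "m + 1 = 2 ^ e * M"
  shows "odd ((m + 2 ^ e) choose 2 ^ e)"
  using assms(2)
proof (induction e arbitrary: m)
  case 0
  then show ?case
    using assms(1) by simp
next
  case (Suc e)
  define n where "n = 2 ^ e * M - 1"
  have "0 < 2 ^ e * M"
    using assms(1) by (auto intro!: Nat.gr0I)
  then have n: "n + 1 = 2 ^ e * M" and m: "m = Suc (2 * n)"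
    using Suc(2) unfolding n_def by auto
  have "even ((m + 2 ^ Suc e) choose 2 ^ Suc e) = even (Suc (2 * (n + 2 ^ e)) choose (2 * 2 ^ e))"
    by (simp add: m)
  also have "\<dots> = even ((n + 2 ^ e) choose 2 ^ e)"
    by (rule even_choose_odd)
  finally show ?case
    using Suc.IH [OF n] by simp
qed

text \<open>After adding 1 to both sides, the defining congruence says that 2^e is the exact power
  of 2 dividing m + 1.\<close>

lemma ones_block_eq:
  assumes "odd M" "m + 1 = 2 ^ e * M"
  shows "ones_block m = e"
proof -
  have iff: "[m = 2 ^ f - 1] (mod 2 ^ (f + 1)) \<longleftrightarrow> 2 ^ f dvd m + 1 \<and> \<not> 2 ^ (f + 1) dvd m + 1" for f
  proof -
    have "[m = 2 ^ f - 1] (mod 2 ^ (f + 1)) \<longleftrightarrow> [m + 1 = 2 ^ f - 1 + 1] (mod 2 ^ (f + 1))"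
      by (rule cong_add_rcancel_nat [symmetric])
    also have "\<dots> \<longleftrightarrow> (m + 1) mod (2 * 2 ^ f) = 2 ^ f"
      by (simp add: cong_def)
    also have "\<dots> \<longleftrightarrow> 2 ^ f dvd m + 1 \<and> \<not> 2 ^ (f + 1) dvd m + 1"
    proof
      assume *: "(m + 1) mod (2 * 2 ^ f) = 2 ^ f"
      have "2 ^ f dvd (m + 1) mod (2 * 2 ^ f)"
        unfolding * by simp
      then have "2 ^ f dvd m + 1"
        by (simp add: dvd_mod_iff)
      then show "2 ^ f dvd m + 1 \<and> \<not> 2 ^ (f + 1) dvd m + 1"
        using * by (auto simp: dvd_eq_mod_eq_0)
    next
      assume *: "2 ^ f dvd m + 1 \<and> \<not> 2 ^ (f + 1) dvd m + 1"
      then obtain c where c: "m + 1 = 2 ^ f * c"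
        by blast
      with * have "odd c"
        by auto
      then show "(m + 1) mod (2 * 2 ^ f) = 2 ^ f"
        unfolding c by (simp add: mult.commute [of 2] odd_iff_mod_2_eq_one mult_mod_right [symmetric])
    qed
    finally show ?thesis .
  qed
  show ?thesis
    unfolding ones_block_def iff
  proof (rule the_equality)
    show "2 ^ e dvd m + 1 \<and> \<not> 2 ^ (e + 1) dvd m + 1"
      using assms by auto
  next
    fix f
    assume f: "2 ^ f dvd m + 1 \<and> \<not> 2 ^ (f + 1) dvd m + 1"
    have "e < f + 1"
      using f assms(2) by (metis dvd_triv_left le_imp_power_dvd dvd_trans not_less)
    moreover have "f < e + 1"
    proof (rule ccontr)
      assume "\<not> f < e + 1"
      then have "2 ^ (e + 1) dvd m + 1"
        using f by (metis le_imp_power_dvd dvd_trans not_less)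
      then show False
        using assms by auto
    qed
    ultimately show "f = e"
      by simp
  qed
qed

lemma exists_odd_part: "0 < n \<Longrightarrow> \<exists>e M. odd M \<and> n = 2 ^ e * M" for n :: nat
proof (induction n rule: less_induct)
  case (less n)
  show ?case
  proof (cases "even n")
    case True
    then obtain k where k: "n = 2 * k" ..
    then have "k < n" "0 < k"
      using less.prems by simp_all
    then obtain e M where "odd M" "k = 2 ^ e * M"
      using less.IH by blast
    then have "odd M \<and> n = 2 ^ Suc e * M"
      using k by simp
    then show ?thesis by blast
  next
    case False
    then show ?thesis
      by (intro exI [of _ 0] exI [of _ n]) simp
  qed
qed

text \<open>The $r_l$ are the multiplicities chosen by the greedy algorithm that writes
  $m - (2^e - 1)$ as a sum of numbers $d_l$ with odd binomial coefficient. It leaves no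
  remainder, since its last step uses $d_t = 2^e$, which divides $m - (2^e - 1)$ and every $d_l$.\<close>

lemma greedy_decomposition:
  assumes "0 < m" and not_power: "\<nexists>j::nat. m + 1 = 2 ^ j" and M: "odd M" "m + 1 = 2 ^ e * M"
  obtains xs where "\<And>x. x \<in> set xs \<Longrightarrow> odd ((m + x) choose m)"
    "sum_list xs = m - (2 ^ e - 1)" "r_bound m = 1 + int (length xs)"
proof -
  define E :: nat where "E = 2 ^ e"
  have E: "0 < E" and e: "ones_block m = e"
    using ones_block_eq [OF M] by (simp_all add: E_def)
  have EM: "m + 1 = E * M"
    using M by (simp add: E_def)
  have M0: "0 < M"
    using M(1) by (auto intro!: Nat.gr0I)
  define k where "k = bit_len m"
  have "0 < k \<and> m < 2 ^ k"
    unfolding k_def bit_len_def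
    by (rule LeastI [of _ "Suc m"]) (use less_exp [of "Suc m"] in linarith)
  then have mk: "m < 2 ^ k"
    by simp
  \<comment> \<open>As m + 1 is not a power of 2, the inequality is strict and d_0 = 2^k - (m + 1)
    is positive.\<close>
  then have "m + 1 < 2 ^ k"
    using not_power by (metis Suc_eq_plus1 Suc_leI le_neq_implies_less)
  moreover have "e \<le> k"
  proof -
    have "2 ^ e \<le> m + 1"
      using M M0 by simp
    then have "(2::nat) ^ e < 2 ^ k"
      using \<open>m + 1 < 2 ^ k\<close> by linarith
    then show ?thesis
      by simp
  qed
  then have "E dvd 2 ^ k"
    by (simp add: E_def le_imp_power_dvd)
  ultimately have dvd: "E dvd 2 ^ k - (m + 1)" and pos: "0 < 2 ^ k - (m + 1)"
    using EM by (auto intro: dvd_diff_nat)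
  obtain c where c: "2 ^ k - (m + 1) = E * c"
    using dvd by (rule dvdE)
  moreover have "c \<noteq> 0"
    using pos unfolding c by simp
  \<comment> \<open>With d_0 = E(t + 1) this t is the last index: d_l = E(t + 1 - l), down to d_t =
    E.\<close>
  ultimately obtain t where t: "2 ^ k - (m + 1) = E * Suc t"
    using not0_implies_Suc by blast
  have dd: "dd m l = E * (Suc t - l)" for l
    using t by (simp add: dd_def e k_def [symmetric] E_def [symmetric] diff_mult_distrib2)
  have last: "last_idx m = t"
    using E by (simp add: last_idx_def dd e E_def [symmetric])
  \<comment> \<open>What is still to be represented before step l of the greedy algorithm.\<close>
  define R where "R l = int m - (int E - 1) - (\<Sum>i<l. int (dd m i) * rr m i)" for l
  have rr: "rr m l = (if odd ((m + dd m l) choose m) then R l div int (dd m l) else 0)" for l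
  proof -
    have "(m + dd m l) choose dd m l = (m + dd m l) choose m"
      using binomial_symmetric [of m "m + dd m l"] by simp
    moreover have "[n = 1] (mod 2) \<longleftrightarrow> odd n" for n :: nat
      by (simp add: cong_def odd_iff_mod_2_eq_one)
    moreover have "\<lfloor>real_of_int a / real d\<rfloor> = a div int d" for a d
      using floor_divide_of_int_eq [of a "int d"] by simp
    moreover have "rr m l = (if [(m + dd m l) choose dd m l = 1] (mod 2)
        then \<lfloor>real_of_int (R l) / real (dd m l)\<rfloor> else 0)"
      by (subst rr.simps) (simp only: R_def e E_def of_nat_power of_nat_numeral)
    ultimately show ?thesis
      by (simp only:)
  qed
  have step: "R (Suc l) = R l - int (dd m l) * rr m l" for l
    by (simp add: R_def)
  \<comment> \<open>Up to l = t the divisor d_l is positive, so no step overshoots. Then each r_l is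
    non-negative, and the conversions by \<open>nat\<close> below lose nothing.\<close>
  have R_nonneg: "0 \<le> R l" if "l \<le> Suc t" for l
    using that
  proof (induction l)
    case 0
    have "E \<le> m + 1"
      using EM M0 by simp
    then show ?case
      by (simp add: R_def)
  next
    case (Suc l)
    have "0 < int (dd m l)"
      using Suc.prems E by (simp add: dd)
    then have "R l - int (dd m l) * (R l div int (dd m l)) \<ge> 0"
      by (simp add: minus_mult_div_eq_mod)
    then show ?case
      using Suc unfolding step rr by simp
  qed
  have rr_nonneg: "0 \<le> rr m l" if "l \<le> t" for l
    using R_nonneg [of l] that by (simp add: rr pos_imp_zdiv_nonneg_iff dd E div_int_pos_iff)
  have "int E dvd R t"
  proof -
    have "int m - (int E - 1) = int E * (int M - 1)"
      using arg_cong [OF EM, of int] by (simp add: algebra_simps)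
    moreover have "int E dvd (\<Sum>i<t. int (dd m i) * rr m i)"
      by (intro dvd_sum) (simp add: dd)
    ultimately show ?thesis
      by (simp add: R_def)
  qed
  moreover have "rr m t = R t div int E"
    using odd_choose_add_power2 [OF M] binomial_symmetric [of m "m + E"]
    by (simp add: rr dd E_def)
  ultimately have "R (Suc t) = 0"
    unfolding step by (simp add: dd)
  then have total: "(\<Sum>l<Suc t. int (dd m l) * rr m l) = int m - (int E - 1)"
    unfolding R_def by simp
  define xs where "xs = concat (map (\<lambda>l. replicate (nat (rr m l)) (dd m l)) [0..<Suc t])"
  show thesis
  proof
    fix x
    assume "x \<in> set xs"
    then obtain l where "x = dd m l" "rr m l \<noteq> 0"
      unfolding xs_def by (auto simp del: upt_Suc split: if_splits)
    then show "odd ((m + x) choose m)"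
      using rr [of l] by (simp split: if_splits)
  next
    have sum_concat: "sum_list (concat yss) = sum_list (map sum_list yss)" for yss :: "nat list list"
      by (induction yss) simp_all
    have "int (sum_list xs) = (\<Sum>l<Suc t. int (dd m l) * rr m l)"
    proof -
      have "sum_list xs = (\<Sum>l<Suc t. nat (rr m l) * dd m l)"
        unfolding xs_def sum_concat map_map comp_def sum_list_replicate
        by (subst interv_sum_list_conv_sum_set_nat) (simp add: atLeast0LessThan)
      then show ?thesis
        using rr_nonneg by (auto intro!: sum.cong simp: mult.commute)
    qed
    then have "int (sum_list xs) = int m - (int E - 1)"
      using total by simp
    then show "sum_list xs = m - (2 ^ e - 1)"
      using E unfolding E_def [symmetric] by linarith
  next
    have "length xs = (\<Sum>l<Suc t. nat (rr m l))"
      unfolding xs_def length_concat map_map comp_def length_replicate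
      by (subst interv_sum_list_conv_sum_set_nat) (simp add: atLeast0LessThan)
    then have "int (length xs) = (\<Sum>l<Suc t. rr m l)"
      using rr_nonneg by (auto intro!: sum.cong)
    then show "r_bound m = 1 + int (length xs)"
      by (simp add: r_bound_def last lessThan_Suc_atMost atLeast0AtMost)
  qed
qed

section \<open>The stable gap\<close>

text \<open>The cup-length counts single factors indexed by an initial segment of the naturals, so a
  product of powers has to be listed factor by factor.\<close>

lemma prod_as_function:
  fixes y :: "'a \<Rightarrow> 'b::comm_monoid_mult"
  assumes "finite A"
  shows "\<exists>g. (\<forall>j<sum f A. g j \<in> y ` A) \<and> prod g {..<sum f A} = (\<Prod>i\<in>A. y i ^ f i)"
proof -
  have "\<exists>xs. set xs \<subseteq> y ` A \<and> length xs = sum f A \<and> prod_list xs = (\<Prod>i\<in>A. y i ^ f i)"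
    using assms
  proof (induction A rule: finite_induct)
    case empty
    show ?case by simp
  next
    case (insert a A)
    then obtain xs where "set xs \<subseteq> y ` A" "length xs = sum f A" "prod_list xs = (\<Prod>i\<in>A. y i ^ f i)"
      by blast
    then show ?case
      using insert.hyps
      by (intro exI [of _ "replicate (f a) (y a) @ xs"]) (auto simp: prod_list_replicate)
  qed
  then obtain xs where "set xs \<subseteq> y ` A" "length xs = sum f A" "prod_list xs = (\<Prod>i\<in>A. y i ^ f i)"
    by blast
  then show ?thesis
    by (intro exI [of _ "nth xs"]) (auto simp: prod.list_conv_set_nth atLeast0LessThan subset_iff)
qed

text \<open>The bound on powers of the ideal and the surviving monomial meet at the same number
  \<open>N\<close> of factors.\<close>

lemma gap_eq:
  assumes "m + 1 = 2 ^ e * M" "odd M" "length xs < s"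
    and xs: "\<And>x. x \<in> set xs \<Longrightarrow> odd ((m + x) choose m)" "sum_list xs = m - (2 ^ e - 1)"
  shows "gap s m = 2 ^ e - 1"
proof -
  define N where "N = s * m - (2 ^ e - 1)"
  let ?S = "{n. \<exists>g. (\<forall>j<n. g j \<in> polys_over {1..s} \<and> diag_poly (g j) \<in> trunc_polys 1 m)
    \<and> prod g {..<n} \<notin> trunc_polys s m}"
  have s: "1 \<le> s"
    using assms(3) by simp
  have e: "2 ^ e - 1 \<le> m"
  proof -
    have "0 < M"
      using assms(2) by (auto intro!: Nat.gr0I)
    then have "2 ^ e * 1 \<le> 2 ^ e * M"
      by (intro mult_le_mono2) simp
    then show ?thesis
      using assms(1) by linarith
  qed
  have sm: "m \<le> s * m"
    using s by simp
  have "n \<le> N" if n: "n \<in> ?S" for n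
  proof (rule ccontr)
    assume "\<not> n \<le> N"
    then have "s * m < n + (2 ^ e - 1)"
      unfolding N_def by linarith
    then have trunc: "diff_ideal_power s m n \<subseteq> trunc_polys s m"
      by (rule diff_ideal_power_trunc [OF assms(1) s])
    obtain g where g: "\<forall>j<n. g j \<in> polys_over {1..s} \<and> diag_poly (g j) \<in> trunc_polys 1 m"
      and nz: "prod g {..<n} \<notin> trunc_polys s m"
      using n by blast
    have "prod g {..<n} \<in> diff_ideal_power s m n"
      using g s by (intro diff_ideal_power_prod diag_kernel_in_ideal) simp_all
    then show False
      using trunc nz by blast
  qed
  moreover have "N \<in> ?S"
  proof -
    \<comment> \<open>One entry is needed for each i in {2..s}; \<open>length xs < s\<close> leaves
      room for the padding. The entry 0 is admissible because m choose m = 1, and it does not change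
      the sum.\<close>
    define ys where "ys = xs @ replicate (s - 1 - length xs) 0"
    have len: "length ys = s - 1" and ys_sum: "sum_list ys = m - (2 ^ e - 1)"
      and odd: "\<And>x. x \<in> set ys \<Longrightarrow> odd ((m + x) choose m)"
      using assms(3) xs by (auto simp: ys_def sum_list_replicate)
    \<comment> \<open>List positions start at 0, the variables other than the base variable at
      2.\<close>
    define d where "d i = ys ! (i - 2)" for i
    have d_odd: "odd ((m + d i) choose m)" if "i \<in> {2..s}" for i
      using that len unfolding d_def by (intro odd nth_mem) auto
    have d_sum: "sum d {2..s} = m - (2 ^ e - 1)"
    proof -
      have "sum d {2..s} = (\<Sum>j\<in>{0..<s - 1}. ys ! j)"
        by (rule sum.reindex_bij_witness [of _ "\<lambda>j. j + 2" "\<lambda>i. i - 2"]) (auto simp: d_def)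
      then show ?thesis
        using ys_sum by (simp add: len sum_list_sum_nth)
    qed
    have nz: "(\<Prod>i\<in>{2..s}. (indet i + indet 1) ^ (m + d i)) \<notin> trunc_polys s m"
      by (rule diff_product_not_trunc [OF d_odd]) (simp_all only: d_sum diff_le_self)
    have "(\<Sum>i\<in>{2..s}. m + d i) = (s - 1) * m + (m - (2 ^ e - 1))"
      by (simp add: sum.distrib d_sum)
    also have "\<dots> = N"
      using e s by (cases s) (auto simp: N_def)
    finally have N: "(\<Sum>i\<in>{2..s}. m + d i) = N" .
    obtain g where g: "\<forall>j<N. g j \<in> (\<lambda>i. indet i + indet 1) ` {2..s}"
      and prod: "prod g {..<N} = (\<Prod>i\<in>{2..s}. (indet i + indet 1) ^ (m + d i))"
      using prod_as_function [of "{2..s}" "\<lambda>i. m + d i" "\<lambda>i. indet i + indet 1"] unfolding N by auto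
    have "g j \<in> polys_over {1..s} \<and> diag_poly (g j) \<in> trunc_polys 1 m" if j: "j < N" for j
    proof -
      obtain i where "i \<in> {2..s}" "g j = indet i + indet 1"
        using g j by blast
      then show ?thesis
        by (auto simp: diag_poly_add poly2_add_self intro!: polys_over_closed)
    qed
    then show ?thesis
      using nz unfolding prod [symmetric] by blast
  qed
  ultimately have "Max ?S = N"
    by (intro Max_eqI) (auto intro: finite_subset [of _ "{..N}"])
  then have "zcl_RP s m = N"
    by (simp only: zcl_RP_eq [OF s])
  moreover have "2 ^ e - 1 \<le> s * m"
    using e sm by linarith
  ultimately show ?thesis
    by (simp add: gap_def N_def of_nat_diff)
qed

theorem theorem3p5:
  fixes m :: nat
  assumes "0 < m" and "\<nexists>j::nat. m + 1 = 2 ^ j"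
  shows "int (stab_index m) \<le> r_bound m"
proof -
  obtain e M where M: "odd M" "m + 1 = 2 ^ e * M"
    using exists_odd_part [of "m + 1"] by auto
  obtain xs where xs: "\<And>x. x \<in> set xs \<Longrightarrow> odd ((m + x) choose m)"
    "sum_list xs = m - (2 ^ e - 1)" and r: "r_bound m = 1 + int (length xs)"
    using greedy_decomposition [OF assms M] by blast
  have gap: "gap s m = 2 ^ e - 1" if "length xs < s" for s
    using gap_eq [OF M(2,1) that xs] by simp
  \<comment> \<open>\<open>stab_index\<close> admits only indices from 2 on, so
    \<open>Suc (length xs)\<close> must be at least 2. An empty list would force m \<le> 2^e - 1,
    but M is odd and not 1, so m + 1 is at least twice 2^e.\<close>
  have "xs \<noteq> []"
  proof
    assume "xs = []"
    moreover have "M \<noteq> 1"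
      using assms(2) M(2) by auto
    then have "2 ^ e * 2 \<le> 2 ^ e * M"
      using M(1) by (intro mult_le_mono2) (cases M; auto)
    moreover have "(1::nat) \<le> 2 ^ e"
      by simp
    ultimately show False
      using xs(2) M(2) by simp
  qed
  have "stable_gap m = 2 ^ e - 1"
    unfolding stable_gap_def
  proof (rule the_equality)
    show "\<forall>\<^sub>F s in sequentially. gap s m = 2 ^ e - 1"
      using gap eventually_gt_at_top by (rule eventually_mono [rotated])
    \<comment> \<open>Two eventual values of one sequence are attained together at some s.\<close>
    then show "c = 2 ^ e - 1" if "\<forall>\<^sub>F s in sequentially. gap s m = c" for c
      using eventually_happens' [OF sequentially_bot eventually_conj [OF that]] by force
  qed
  then have "stab_index m \<le> Suc (length xs)"
    unfolding stab_index_def using gap \<open>xs \<noteq> []\<close> by (intro Least_le) (auto simp: Suc_le_eq)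
  then show ?thesis
    unfolding r by simp
qed

end
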